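(* Let $T,k$ be positive integers and $w=\lceil T/k\rceil$. Consider a system of time-bucketed balance record structures (as defined in the context), all initially empty, to which an arbitrary finite sequence of operations (Deposit, Consume, Transfer, Prune, with arbitrary positive amounts and arbitrary sender/recipient choices, including arbitrarily many deposits by an adversary into a victim's structure) is applied at nondecreasing integer times. Then there is a constant $C$, independent of $k$, $T$ and of the sequence of operations, such that every single operation on any structure performs at most $C(k+1)^2$ elementary steps (record reads, writes, comparisons and shifts); in particular Insert, Consume and Prune each perform $O(k)$ steps and Transfer performs $O(k^2)$ steps, independently of the number of previous deposits.
   Context: Times are nonnegative integers. A balance record structure is a finite list $\mathcal{B}=[(a_1,e_1),\dots,(a_n,e_n)]$ of pairs (amount $a_i\ge 0$, expiration timestamp $e_i$), kept sorted with $e_1<e_2<\dots<e_n$. Fix a TTL $T$ and bucket width $w=\lceil T/k\rceil$, and define $\mathrm{BucketedExpiry}(t)=\lceil (t+T)/w\rceil\cdot w$. The operations, performed at current time $t_{\mathrm{now}}$, are: - Prune$(\mathcal{B},t_{\mathrm{now}})$: a single pass deleting every record with $e_i\le t_{\mathrm{now}}$ or $a_i=0$, keeping the order of the remaining ones. - Insert$(\mathcal{B},a,e,t_{\mathrm{now}})$: first run Prune$(\mathcal{B},t_{\mathrm{now}})$; then scan records in order: if a record with $e_i=e$ is found, set $a_i\leftarrow a_i+a$ and stop; if a record with $e_i>e$ is found first, insert $(a,e)$ immediately before it (shifting later records) and stop; if neither occurs, append $(a,e)$ at the end. - Deposit of amount $a>0$ at time $t$: Insert$(\mathcal{B},a,\mathrm{BucketedExpiry}(t),t)$.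 - Consume$(\mathcal{B},a,t_{\mathrm{now}})$: with remaining $r=a$ and an empty list $C$, scan records in order, skipping those with $e_i\le t_{\mathrm{now}}$; for each other record put $\delta=\min(r,a_i)$, set $a_i\leftarrow a_i-\delta$, append $(\delta,e_i)$ to $C$, and $r\leftarrow r-\delta$; if $r=0$ return success and $C$. If the scan ends with $r>0$, return failure. - Transfer of amount $a$ from $\mathcal{B}_s$ to $\mathcal{B}_r$ at time $t_{\mathrm{now}}$: run Consume$(\mathcal{B}_s,a,t_{\mathrm{now}})$; if it fails, stop; otherwise for each $(a_i,e_i)\in C$ run Insert$(\mathcal{B}_r,a_i,e_i,t_{\mathrm{now}})$ (keeping the original expiration $e_i$). *)

theory Defs
  imports Complex_Main "HOL-Library.Monad_Syntax"
begin

section \<open>Step-counting computations\<close>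

text \<open>
  A computation returns its result, the trace of the elementary steps it performed, and a log of
  the procedure calls that were completed in the course of it (at any nesting depth), each with the
  trace of that very call.  The number of steps of a computation or of a call is the length of its
  trace.
\<close>

datatype step = Read | Write | Compare | Shift

datatype procedure = Insert_Proc | Consume_Proc | Prune_Proc

type_synonym 'a run = "'a \<times> step list \<times> (procedure \<times> step list) list"

abbreviation result_of :: "'a run \<Rightarrow> 'a" where
  "result_of m \<equiv> fst m"

abbreviation steps_of :: "'a run \<Rightarrow> step list" where
  "steps_of m \<equiv> fst (snd m)"

abbreviation calls_of :: "'a run \<Rightarrow> (procedure \<times> step list) list" where
  "calls_of m \<equiv> snd (snd m)"

definition return_run :: "'a \<Rightarrow> 'a run" where
  "return_run x = (x, [], [])"

definition bind_run :: "'a run \<Rightarrow> ('a \<Rightarrow> 'b run) \<Rightarrow> 'b run" where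
  "bind_run m f =
     (let m' = f (result_of m)
      in (result_of m', steps_of m @ steps_of m', calls_of m @ calls_of m'))"

adhoc_overloading Monad_Syntax.bind \<rightleftharpoons> bind_run

definition tick :: "step list \<Rightarrow> unit run" where
  "tick ss = ((), ss, [])"

definition call :: "procedure \<Rightarrow> 'a run \<Rightarrow> 'a run" where
  "call p m = (result_of m, steps_of m, calls_of m @ [(p, steps_of m)])"


section \<open>Balance record structures and their procedures\<close>

text \<open>
  Every iteration of a scan is charged, besides the steps on records, one comparison for the test
  whether a further record exists; the failing test at the end of a scan is charged as well.
\<close>

type_synonym time = nat
type_synonym records = "(real \<times> time) list"

definition bucket_width :: "nat \<Rightarrow> nat \<Rightarrow> nat" where
  "bucket_width T k = nat \<lceil>real T / real k\<rceil>"

definition bucketed_expiry :: "nat \<Rightarrow> nat \<Rightarrow> time \<Rightarrow> time" where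
  "bucketed_expiry T k t =
     nat \<lceil>real (t + T) / real (bucket_width T k)\<rceil> * bucket_width T k"

text \<open>
  The pass compacts the structure in place: a kept record is moved to its new position (one
  shift), a deleted one is erased (one write).
\<close>

fun prune_pass :: "time \<Rightarrow> records \<Rightarrow> records run" where
  "prune_pass t [] = do { tick [Compare]; return_run [] }"
| "prune_pass t ((a, e) # B) = do {
     tick [Compare, Read, Compare];
     if e \<le> t then do { tick [Write]; prune_pass t B }
     else do {
       tick [Compare];
       if a = 0 then do { tick [Write]; prune_pass t B }
       else do { tick [Shift]; B' \<leftarrow> prune_pass t B; return_run ((a, e) # B') }
     }
   }"

definition prune :: "time \<Rightarrow> records \<Rightarrow> records run" where
  "prune t B = call Prune_Proc (prune_pass t B)"

fun insert_scan :: "real \<Rightarrow> time \<Rightarrow> records \<Rightarrow> records run" where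
  "insert_scan a e [] = do { tick [Compare, Write]; return_run [(a, e)] }"
| "insert_scan a e ((a', e') # B) = do {
     tick [Compare, Read, Compare];
     if e' = e then do { tick [Write]; return_run ((a' + a, e') # B) }
     else do {
       tick [Compare];
       if e' > e then do {
         tick (replicate (length ((a', e') # B)) Shift);
         tick [Write];
         return_run ((a, e) # (a', e') # B)
       }
       else do { B' \<leftarrow> insert_scan a e B; return_run ((a', e') # B') }
     }
   }"

definition insert_record :: "time \<Rightarrow> real \<Rightarrow> time \<Rightarrow> records \<Rightarrow> records run" where
  "insert_record t a e B =
     call Insert_Proc (do { B' \<leftarrow> prune t B; insert_scan a e B' })"

text \<open>
  The result consists of the updated structure and, in case of success, the list of consumed
  pieces.  The decrements are made in place, so they also persist when the scan fails.
  In the charges for a live record, the comparisons are those of the loop test, of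
  \<open>e \<le> t\<close>, of the minimum, and of \<open>r = 0\<close>; the two writes update the record and extend the list
  of consumed pieces.
\<close>

fun consume_scan :: "time \<Rightarrow> real \<Rightarrow> records \<Rightarrow> (records \<times> records option) run" where
  "consume_scan t r [] = do { tick [Compare]; return_run ([], None) }"
| "consume_scan t r ((a, e) # B) = do {
     tick [Compare, Read, Compare];
     if e \<le> t then do {
       (B', C) \<leftarrow> consume_scan t r B;
       return_run ((a, e) # B', C)
     }
     else do {
       let \<delta> = min r a;
       tick [Compare, Write, Write, Compare];
       if r - \<delta> = 0 then return_run ((a - \<delta>, e) # B, Some [(\<delta>, e)])
       else do {
         (B', C) \<leftarrow> consume_scan t (r - \<delta>) B;
         return_run ((a - \<delta>, e) # B', map_option ((#) (\<delta>, e)) C)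
       }
     }
   }"

definition consume :: "time \<Rightarrow> real \<Rightarrow> records \<Rightarrow> (records \<times> records option) run" where
  "consume t a B = call Consume_Proc (consume_scan t a B)"

fun insert_all :: "time \<Rightarrow> records \<Rightarrow> records \<Rightarrow> records run" where
  "insert_all t [] B = do { tick [Compare]; return_run B }"
| "insert_all t ((a, e) # C) B = do {
     tick [Compare, Read];
     B' \<leftarrow> insert_record t a e B;
     insert_all t C B'
   }"


section \<open>Systems of structures\<close>

text \<open>The structures of a system are named by natural numbers.\<close>

type_synonym system = "nat \<Rightarrow> records"

datatype operation =
    Deposit nat real
  | Consume nat real
  | is_Transfer: Transfer nat nat real
  | Prune nat

fun positive_amount :: "operation \<Rightarrow> bool" where
  "positive_amount (Deposit x a) \<longleftrightarrow> a > 0"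
| "positive_amount (Consume x a) \<longleftrightarrow> a > 0"
| "positive_amount (Transfer s r a) \<longleftrightarrow> a > 0"
| "positive_amount (Prune x) \<longleftrightarrow> True"

text \<open>
  In a transfer the recipient's structure is looked up after the sender's one has been
  updated, so that sender and recipient may coincide.
\<close>

fun perform :: "nat \<Rightarrow> nat \<Rightarrow> time \<Rightarrow> operation \<Rightarrow> system \<Rightarrow> system run" where
  "perform T k t (Deposit x a) \<sigma> = do {
     B \<leftarrow> insert_record t a (bucketed_expiry T k t) (\<sigma> x);
     return_run (\<sigma>(x := B))
   }"
| "perform T k t (Consume x a) \<sigma> = do {
     (B, C) \<leftarrow> consume t a (\<sigma> x);
     return_run (\<sigma>(x := B))
   }"
| "perform T k t (Transfer s r a) \<sigma> = do {
     (B, C) \<leftarrow> consume t a (\<sigma> s);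
     let \<sigma>' = \<sigma>(s := B);
     case C of
       None \<Rightarrow> return_run \<sigma>'
     | Some pieces \<Rightarrow> do {
         B' \<leftarrow> insert_all t pieces (\<sigma>' r);
         return_run (\<sigma>'(r := B'))
       }
   }"
| "perform T k t (Prune x) \<sigma> = do {
     B \<leftarrow> prune t (\<sigma> x);
     return_run (\<sigma>(x := B))
   }"

type_synonym history = "(time \<times> operation) list"

definition admissible :: "history \<Rightarrow> bool" where
  "admissible h \<longleftrightarrow> sorted (map fst h) \<and> (\<forall>(t, opn) \<in> set h. positive_amount opn)"

definition system_after :: "nat \<Rightarrow> nat \<Rightarrow> history \<Rightarrow> system" where
  "system_after T k h =
     fold (\<lambda>(t, opn) \<sigma>. result_of (perform T k t opn \<sigma>)) h (\<lambda>_. [])"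

definition nth_run :: "nat \<Rightarrow> nat \<Rightarrow> history \<Rightarrow> nat \<Rightarrow> system run" where
  "nth_run T k h i = perform T k (fst (h ! i)) (snd (h ! i)) (system_after T k (take i h))"

end

theory Submission
  imports Defs
begin

text \<open>
  Every structure holds strictly sorted expirations, all multiples of \<open>w\<close> lying in
  \<open>{t\<^sub>0 <.. t\<^sub>0 + T + w}\<close>, where \<open>t\<^sub>0\<close> is the time of the last insertion into it: an insertion
  prunes first, consumption adds no record, and a transferred piece is live and its expiration was
  computed at an earlier time.  As \<open>T \<le> k * w\<close>, such an interval contains at most \<open>k + 1\<close>
  multiples of \<open>w\<close>, so a structure never has more than \<open>k + 1\<close> records.  All scans are linear in
  the number of records, and a transfer inserts at most \<open>k + 1\<close> pieces.
\<close>

lemmas run_defs = return_run_def bind_run_def tick_def call_def Let_def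


section \<open>The elementary procedures\<close>

lemma result_prune_pass:
  "result_of (prune_pass t B) = filter (\<lambda>(a, e). t < e \<and> a \<noteq> 0) B"
  by (induction t B rule: prune_pass.induct) (auto simp: run_defs)

lemma steps_prune_pass: "length (steps_of (prune_pass t B)) \<le> 5 * length B + 1"
  by (induction t B rule: prune_pass.induct) (auto simp: run_defs)

lemma calls_prune_pass [simp]: "calls_of (prune_pass t B) = []"
  by (induction t B rule: prune_pass.induct) (auto simp: run_defs)

lemma expirations_insert_scan:
  "snd ` set (result_of (insert_scan a e B)) = insert e (snd ` set B)"
  by (induction a e B rule: insert_scan.induct) (auto simp: run_defs)

text \<open>The scan recurses only past some \<open>e' < e\<close>, and the recursive call adds no
  expiration but \<open>e\<close>, so the head stays below its new tail.\<close>

lemma sorted_insert_scan: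
  "sorted_wrt (<) (map snd B) \<Longrightarrow> sorted_wrt (<) (map snd (result_of (insert_scan a e B)))"
proof (induction a e B rule: insert_scan.induct)
  case (2 a e a' e' B)
  then show ?case
    using expirations_insert_scan[of a e B]
    by (auto simp: run_defs)
qed (simp add: run_defs)

text \<open>Shifting the remaining suffix ends the scan, so it is paid for at most once and the
  total stays linear.\<close>

lemma steps_insert_scan: "length (steps_of (insert_scan a e B)) \<le> 5 * length B + 2"
  by (induction a e B rule: insert_scan.induct) (auto simp: run_defs)

lemma calls_insert_scan [simp]: "calls_of (insert_scan a e B) = []"
  by (induction a e B rule: insert_scan.induct) (auto simp: run_defs)

lemma expirations_consume_scan:
  "map snd (fst (result_of (consume_scan t r B))) = map snd B"
  by (induction t r B rule: consume_scan.induct) (auto simp: run_defs split: prod.splits)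

text \<open>Each live record visited yields one piece with its own expiration. For a transfer this
  bounds the number of insertions and locates the inserted expirations.\<close>

lemma pieces_consume_scan:
  "snd (result_of (consume_scan t r B)) = Some C \<Longrightarrow>
     length C \<le> length B \<and> snd ` set C \<subseteq> {e \<in> snd ` set B. t < e}"
proof (induction t r B arbitrary: C rule: consume_scan.induct)
  case (2 t r a e B)
  show ?case
  proof (cases "e \<le> t")
    case True
    with 2(3) have "snd (result_of (consume_scan t r B)) = Some C"
      by (simp add: run_defs split_beta)
    with 2(1)[OF True, of C] show ?thesis
      by auto
  next
    case False
    show ?thesis
    proof (cases "r - min r a = 0")
      case True
      then have "C = [(min r a, e)]"
        using 2(3) \<open>\<not> e \<le> t\<close> by (simp add: run_defs)
      then show ?thesis
        using \<open>\<not> e \<le> t\<close> by simp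
    next
      case rest: False
      \<comment> \<open>A nonzero remainder means \<open>a < r\<close>, so a scan that continues has
        taken the whole record.\<close>
      then have min: "min r a = a" "r \<noteq> a"
        by (auto simp: min_def split: if_splits)
      then obtain D where "snd (result_of (consume_scan t (r - a) B)) = Some D"
        and "C = (a, e) # D"
        using 2(3) False by (auto simp: run_defs split_beta)
      then show ?thesis
        using 2(2)[OF False refl rest, of D] False min by auto
    qed
  qed
qed (simp add: run_defs)

lemma steps_consume_scan: "length (steps_of (consume_scan t r B)) \<le> 7 * length B + 1"
  by (induction t r B rule: consume_scan.induct) (auto simp: run_defs split: prod.splits)

lemma calls_consume_scan [simp]: "calls_of (consume_scan t r B) = []"
  by (induction t r B rule: consume_scan.induct) (auto simp: run_defs split: prod.splits)


section \<open>The bound on the number of records\<close>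

text \<open>The open lower end matches the expiry test \<open>e \<le> t\<close>; the extra width
  above \<open>t + T\<close> allows for rounding up.\<close>

definition buckets :: "nat \<Rightarrow> nat \<Rightarrow> time \<Rightarrow> time set" where
  "buckets T k t = {e. t < e \<and> e \<le> t + T + bucket_width T k \<and> bucket_width T k dvd e}"

lemma bucket_width_pos: "0 < T \<Longrightarrow> 0 < k \<Longrightarrow> 0 < bucket_width T k"
  by (simp add: bucket_width_def)

lemma le_mult_bucket_width:
  assumes "0 < k"
  shows "T \<le> k * bucket_width T k"
proof -
  have "real T / real k \<le> real (bucket_width T k)"
    unfolding bucket_width_def by (rule of_nat_ceiling)
  then have "real T \<le> real (k * bucket_width T k)"
    using assms by (simp add: field_simps)
  then show ?thesis
    by (simp only: of_nat_le_iff)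
qed

lemma bucketed_expiry_in_buckets:
  assumes "0 < T" "0 < k"
  shows "bucketed_expiry T k t \<in> buckets T k t"
proof -
  define w where "w = bucket_width T k"
  define q where "q = nat \<lceil>real (t + T) / real w\<rceil>"
  have w: "0 < w"
    using bucket_width_pos[OF assms] by (simp add: w_def)
  have "real (t + T) / real w \<le> real q"
    unfolding q_def by (rule of_nat_ceiling)
  then have "real (t + T) \<le> real (q * w)"
    using w by (simp add: field_simps)
  then have lower: "t + T \<le> q * w"
    by (simp only: of_nat_le_iff)
  have "real q = of_int \<lceil>real (t + T) / real w\<rceil>"
    by (simp add: q_def)
  then have "real q \<le> real (t + T) / real w + 1"
    using ceiling_correct[of "real (t + T) / real w"] by linarith
  then have "real (q * w) \<le> real (t + T + w)"
    using w by (simp add: field_simps)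
  then have upper: "q * w \<le> t + T + w"
    by (simp only: of_nat_le_iff)
  have "bucketed_expiry T k t = q * w"
    by (simp add: bucketed_expiry_def q_def w_def)
  \<comment> \<open>Positivity of \<open>T\<close> turns \<open>t + T \<le> q * w\<close> into the
    strict \<open>t < q * w\<close>.\<close>
  with lower upper show ?thesis
    using assms by (simp add: buckets_def flip: w_def)
qed

lemma finite_buckets [simp]: "finite (buckets T k t)"
  by (rule finite_subset[of _ "{..t + T + bucket_width T k}"]) (auto simp: buckets_def)

lemma card_buckets_le:
  assumes "0 < T" "0 < k"
  shows "card (buckets T k t) \<le> k + 1"
proof -
  define w where "w = bucket_width T k"
  have w: "0 < w"
    using bucket_width_pos[OF assms] by (simp add: w_def)
  have "buckets T k t \<subseteq> (\<lambda>j. w * j) ` {t div w <.. t div w + (k + 1)}"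
  proof
    fix e assume "e \<in> buckets T k t"
    then obtain j where j: "e = w * j" "t < w * j" "w * j \<le> t + T + w"
      by (auto simp: buckets_def simp flip: w_def)
    have "t div w < j"
      using j(2) w by (simp add: div_less_iff_less_mult mult.commute)
    \<comment> \<open>Rounding the window end up to \<open>t\<close> plus a multiple of
      \<open>w\<close> lets \<open>div\<close> split exactly, so the offset of \<open>t\<close>
      within its bucket costs no extra candidate.\<close>
    moreover have "w * j \<le> t + (k + 1) * w"
      using j(3) le_mult_bucket_width[OF assms(2), of T] by (simp flip: w_def)
    then have "(w * j) div w \<le> (t + (k + 1) * w) div w"
      by (rule div_le_mono)
    then have "j \<le> t div w + (k + 1)"
      using w by (simp del: mult_Suc)
    ultimately show "e \<in> (\<lambda>j. w * j) ` {t div w <.. t div w + (k + 1)}"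
      using j(1) by auto
  qed
  then have "card (buckets T k t) \<le> card {t div w <.. t div w + (k + 1)}"
    by (intro surj_card_le) auto
  then show ?thesis
    by simp
qed

text \<open>Expired records may linger, so \<open>t\<close> is the time at which the window was
  fixed and need not be the current time.\<close>

definition bucketed :: "nat \<Rightarrow> nat \<Rightarrow> time \<Rightarrow> records \<Rightarrow> bool" where
  "bucketed T k t B \<longleftrightarrow> sorted_wrt (<) (map snd B) \<and> snd ` set B \<subseteq> buckets T k t"

lemma length_bucketed_le:
  assumes "0 < T" "0 < k" "bucketed T k t B"
  shows "length B \<le> k + 1"
proof -
  have "distinct (map snd B)"
    using assms(3) by (simp add: bucketed_def strict_sorted_iff)
  then have "length B = card (snd ` set B)"
    using distinct_card[of "map snd B"] by simp
  also have "\<dots> \<le> card (buckets T k t)"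
    using assms(3) by (intro card_mono) (auto simp: bucketed_def)
  also have "\<dots> \<le> k + 1"
    using assms(1,2) by (rule card_buckets_le)
  finally show ?thesis .
qed

text \<open>Later windows also end later, so only the lower bound can fail, and liveness restores
  it. This serves both the survivors of a pruning and transferred pieces.\<close>

lemma live_buckets_mono: "t0 \<le> t \<Longrightarrow> e \<in> buckets T k t0 \<Longrightarrow> t < e \<Longrightarrow> e \<in> buckets T k t"
  by (auto simp: buckets_def)

lemma bucketed_prune:
  assumes "bucketed T k t0 B" "t0 \<le> t"
  shows "bucketed T k t (result_of (prune t B))"
  using assms live_buckets_mono[OF assms(2)]
  by (fastforce simp: bucketed_def prune_def call_def result_prune_pass sorted_wrt_map
      intro: sorted_wrt_filter)

lemma bucketed_insert_record:
  assumes "bucketed T k t0 B" "t0 \<le> t" "e \<in> buckets T k t"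
  shows "bucketed T k t (result_of (insert_record t a e B))"
  using bucketed_prune[OF assms(1,2)] assms(3)
  by (simp add: bucketed_def insert_record_def call_def bind_run_def Let_def
      sorted_insert_scan expirations_insert_scan)

text \<open>Expired records are skipped but not deleted, so the window stays at \<open>t0\<close>
  and does not advance to \<open>t\<close>.\<close>

lemma bucketed_consume:
  assumes "bucketed T k t0 B"
  shows "bucketed T k t0 (fst (result_of (consume t a B)))"
proof -
  have "map snd (fst (result_of (consume t a B))) = map snd B"
    by (simp add: consume_def call_def expirations_consume_scan)
  then show ?thesis
    using assms unfolding bucketed_def by (metis set_map)
qed


section \<open>Costs\<close>

text \<open>Additive constants are absorbed by \<open>1 \<le> k\<close>:
  \<open>5 * (k + 1) + 1 \<le> 11 * k\<close>. Likewise \<open>10 * (k + 1) + 3 \<le> 23 * k\<close>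
  for an insertion with its pruning, and \<open>7 * (k + 1) + 1 \<le> 15 * k\<close> for
  consumption.\<close>

lemma prune_cost:
  assumes "length B \<le> k + 1" "0 < k"
  shows "length (steps_of (prune t B)) \<le> 11 * k"
    and "(p, ss) \<in> set (calls_of (prune t B)) \<Longrightarrow> length ss \<le> 11 * k"
  using steps_prune_pass[of t B] assms by (auto simp: prune_def call_def)

lemma insert_record_cost:
  assumes "length B \<le> k + 1" "0 < k"
  shows "length (steps_of (insert_record t a e B)) \<le> 23 * k"
    and "(p, ss) \<in> set (calls_of (insert_record t a e B)) \<Longrightarrow> length ss \<le> 23 * k"
proof -
  have "length (result_of (prune t B)) \<le> length B"
    by (simp add: prune_def call_def result_prune_pass)
  moreover have "length (steps_of (prune t B)) \<le> 5 * length B + 1"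
    using steps_prune_pass[of t B] by (simp add: prune_def call_def)
  ultimately show *: "length (steps_of (insert_record t a e B)) \<le> 23 * k"
    using steps_insert_scan[of a e "result_of (prune t B)"] assms
    by (simp add: insert_record_def call_def bind_run_def Let_def)
  show "length ss \<le> 23 * k" if mem: "(p, ss) \<in> set (calls_of (insert_record t a e B))"
  proof -
    consider "(p, ss) \<in> set (calls_of (prune t B))"
      | "ss = steps_of (insert_record t a e B)"
      using mem by (fastforce simp: insert_record_def call_def bind_run_def Let_def)
    then show ?thesis
      using prune_cost(2)[OF assms, of p ss t] * by cases auto
  qed
qed

lemma consume_cost:
  assumes "length B \<le> k + 1" "0 < k"
  shows "length (steps_of (consume t a B)) \<le> 15 * k"
    and "(p, ss) \<in> set (calls_of (consume t a B)) \<Longrightarrow> length ss \<le> 15 * k"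
  using steps_consume_scan[of t a B] assms by (auto simp: consume_def call_def)

text \<open>Each piece costs \<open>23 * k\<close> for its insertion and two loop steps, hence
  \<open>25 * k\<close>. The window time is existential because an empty list leaves the recipient
  unpruned.\<close>

lemma insert_all_spec:
  assumes "0 < T" "0 < k" "bucketed T k t0 B" "t0 \<le> t" "snd ` set C \<subseteq> buckets T k t"
  shows "(\<exists>t0\<le>t. bucketed T k t0 (result_of (insert_all t C B))) \<and>
    length (steps_of (insert_all t C B)) \<le> length C * (25 * k) + 1 \<and>
    (\<forall>(p, ss) \<in> set (calls_of (insert_all t C B)). length ss \<le> 23 * k)"
  using assms(3-5)
proof (induction t C B arbitrary: t0 rule: insert_all.induct)
  case (1 t B)
  then show ?case
    by (auto simp: run_defs)
next
  case (2 t a e C B)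
  let ?I = "insert_record t a e B"
  have "length B \<le> k + 1"
    using length_bucketed_le[OF assms(1,2) 2(2)] .
  note cost = insert_record_cost[OF this assms(2), where t = t and a = a and e = e]
  have "bucketed T k t (result_of ?I)"
    using bucketed_insert_record[OF 2(2,3)] 2(4) by simp
  from 2(1)[OF this] have IH:
    "\<exists>t0\<le>t. bucketed T k t0 (result_of (insert_all t C (result_of ?I)))"
    "length (steps_of (insert_all t C (result_of ?I))) \<le> length C * (25 * k) + 1"
    "\<forall>(p, ss) \<in> set (calls_of (insert_all t C (result_of ?I))). length ss \<le> 23 * k"
    using 2(4) by auto
  show ?case
    using IH cost assms(2) by (auto simp: run_defs)
qed

text \<open>Each structure has its own \<open>t0\<close>, since an operation refreshes at most one
  window. The dominant cost is a transfer: \<open>15 * k\<close> to consume and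
  \<open>50 * k\<^sup>2 + 1\<close> to insert.\<close>

lemma perform_spec:
  assumes "0 < T" "0 < k" and inv: "\<And>x. \<exists>t0\<le>t. bucketed T k t0 (\<sigma> x)"
  shows "(\<forall>x. \<exists>t0\<le>t. bucketed T k t0 (result_of (perform T k t opn \<sigma>) x)) \<and>
    length (steps_of (perform T k t opn \<sigma>)) \<le> 66 * k\<^sup>2 \<and>
    (\<forall>(p, ss) \<in> set (calls_of (perform T k t opn \<sigma>)). length ss \<le> 23 * k)"
proof -
  have len: "length (\<sigma> x) \<le> k + 1" for x
    using inv[of x] length_bucketed_le[OF assms(1,2)] by blast
  have linear: "n \<le> 66 * k\<^sup>2" if "n \<le> 23 * k" for n
  proof -
    have "k \<le> k\<^sup>2"
      by (simp add: power2_eq_square)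
    with that show ?thesis by linarith
  qed
  show ?thesis
  proof (cases opn)
    case (Deposit x a)
    let ?e = "bucketed_expiry T k t"
    obtain t0 where t0: "t0 \<le> t" "bucketed T k t0 (\<sigma> x)"
      using inv by blast
    note cost = insert_record_cost[OF len[of x] assms(2), where t = t and a = a and e = ?e]
    have "bucketed T k t (result_of (insert_record t a ?e (\<sigma> x)))"
      by (rule bucketed_insert_record[OF t0(2,1) bucketed_expiry_in_buckets[OF assms(1,2)]])
    then show ?thesis
      using inv cost linear Deposit by (auto simp: run_defs)
  next
    case (Consume x a)
    obtain t0 where t0: "t0 \<le> t" "bucketed T k t0 (\<sigma> x)"
      using inv by blast
    note cost = consume_cost[OF len[of x] assms(2), where t = t and a = a]
    show ?thesis
      using inv t0(1) bucketed_consume[OF t0(2), of t a] cost linear Consume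
      by (fastforce simp: run_defs split: prod.splits)
  next
    case (Prune x)
    obtain t0 where t0: "t0 \<le> t" "bucketed T k t0 (\<sigma> x)"
      using inv by blast
    note cost = prune_cost[OF len[of x] assms(2), where t = t]
    show ?thesis
      using inv bucketed_prune[OF t0(2,1)] cost linear Prune
      by (fastforce simp: run_defs)
  next
    case (Transfer s r a)
    obtain t0 where t0: "t0 \<le> t" "bucketed T k t0 (\<sigma> s)"
      using inv by blast
    note cost = consume_cost[OF len[of s] assms(2), where t = t and a = a]
    obtain B C where BC: "result_of (consume t a (\<sigma> s)) = (B, C)"
      by fastforce
    define \<sigma>' where "\<sigma>' = \<sigma>(s := B)"
    \<comment> \<open>Stated for every structure of \<open>\<sigma>'\<close>, this also covers a
      transfer with \<open>r = s\<close>.\<close>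
    have inv': "\<exists>t0\<le>t. bucketed T k t0 (\<sigma>' x)" for x
      using inv[of x] t0(1) bucketed_consume[OF t0(2), of t a] BC by (auto simp: \<sigma>'_def)
    show ?thesis
    proof (cases C)
      case None
      then have "perform T k t opn \<sigma> =
          (\<sigma>', steps_of (consume t a (\<sigma> s)), calls_of (consume t a (\<sigma> s)))"
        using BC Transfer by (simp add: run_defs \<sigma>'_def)
      then show ?thesis
        using inv' cost linear by fastforce
    next
      case (Some ps)
      let ?I = "insert_all t ps (\<sigma>' r)"
      have eq: "perform T k t opn \<sigma> =
          (\<sigma>'(r := result_of ?I), steps_of (consume t a (\<sigma> s)) @ steps_of ?I,
           calls_of (consume t a (\<sigma> s)) @ calls_of ?I)"
        using BC Some Transfer by (simp add: run_defs \<sigma>'_def)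
      have "snd (result_of (consume_scan t a (\<sigma> s))) = Some ps"
        using BC Some by (simp add: consume_def call_def)
      note ps = pieces_consume_scan[OF this]
      have live: "snd ` set ps \<subseteq> buckets T k t"
        using ps t0 by (auto simp: bucketed_def intro: live_buckets_mono)
      obtain t1 where t1: "t1 \<le> t" "bucketed T k t1 (\<sigma>' r)"
        using inv' by blast
      have I: "\<exists>t0\<le>t. bucketed T k t0 (result_of ?I)"
        "length (steps_of ?I) \<le> length ps * (25 * k) + 1"
        "\<forall>(p, ss) \<in> set (calls_of ?I). length ss \<le> 23 * k"
        using insert_all_spec[OF assms(1,2) t1(2,1) live] by simp_all
      \<comment> \<open>There are at most \<open>k + 1\<close> pieces, and
        \<open>k + 1 \<le> 2 * k\<close>.\<close>
      have "length ps \<le> 2 * k"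
        using ps len[of s] assms(2) by linarith
      then have "length ps * (25 * k) \<le> 2 * k * (25 * k)"
        by (rule mult_right_mono) simp
      also have "\<dots> = 50 * k\<^sup>2"
        by (simp add: power2_eq_square)
      finally have "length (steps_of ?I) \<le> 50 * k\<^sup>2 + 1"
        using I(2) by linarith
      moreover have "15 * k + 1 \<le> 16 * k\<^sup>2"
      proof -
        have "k \<le> k\<^sup>2" "1 \<le> k\<^sup>2"
          using assms(2) by (simp_all add: power2_eq_square)
        then show ?thesis by linarith
      qed
      ultimately have "length (steps_of (perform T k t opn \<sigma>)) \<le> 66 * k\<^sup>2"
        using cost(1) by (simp add: eq)
      then show ?thesis
        using inv' I(1,3) cost(2) by (fastforce simp: eq)
    qed
  qed
qed


section \<open>Reachable systems\<close>

lemma bucketed_system_after: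
  assumes "0 < T" "0 < k" "sorted (map fst h)" "\<forall>s \<in> set (map fst h). s \<le> t"
  shows "\<exists>t0\<le>t. bucketed T k t0 (system_after T k h x)"
  using assms(3,4)
proof (induction h arbitrary: t x rule: rev_induct)
  case Nil
  then show ?case
    by (auto simp: system_after_def bucketed_def)
next
  case (snoc y h)
  obtain s opn where y: "y = (s, opn)"
    by fastforce
  have s: "s \<le> t"
    using snoc.prems(2) y by simp
  \<comment> \<open>The induction hypothesis is taken at the time \<open>s\<close> of the last
    operation, as its windows must not start after \<open>s\<close>.\<close>
  have "\<exists>t0\<le>s. bucketed T k t0 (system_after T k h x)" for x
    using snoc.prems y by (intro snoc.IH) (auto simp: sorted_append)
  then obtain t0 where
    "t0 \<le> s" "bucketed T k t0 (result_of (perform T k s opn (system_after T k h)) x)"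
    using perform_spec[OF assms(1,2)] by blast
  moreover have
    "system_after T k (h @ [y]) = result_of (perform T k s opn (system_after T k h))"
    by (simp add: system_after_def y)
  ultimately show ?case
    using s le_trans by metis
qed

lemma nth_run_cost:
  assumes "0 < T" "0 < k" "admissible h" "i < length h"
  shows "length (steps_of (nth_run T k h i)) \<le> 66 * k\<^sup>2 \<and>
    (\<forall>(p, ss) \<in> set (calls_of (nth_run T k h i)). length ss \<le> 23 * k)"
proof -
  have sorted: "sorted (map fst h)"
    using assms(3) by (simp add: admissible_def)
  have "sorted (map fst (take i h))"
    using sorted by (simp flip: take_map)
  moreover have "\<forall>s \<in> set (map fst (take i h)). s \<le> fst (h ! i)"
    using sorted_nth_mono[OF sorted, of _ i] assms(4)
    by (auto simp: in_set_conv_nth simp del: split_paired_All) (metis fst_conv less_imp_le_nat)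
  ultimately have "\<exists>t0\<le>fst (h ! i). bucketed T k t0 (system_after T k (take i h) x)" for x
    by (rule bucketed_system_after[OF assms(1,2)])
  then show ?thesis
    using perform_spec[OF assms(1,2), of "fst (h ! i)" "system_after T k (take i h)"]
    unfolding nth_run_def by blast
qed

theorem theorem3:
  shows "\<exists>C C1 C2 :: nat. \<forall>T k :: nat. \<forall>h :: history.
    T > 0 \<longrightarrow> k > 0 \<longrightarrow> admissible h \<longrightarrow>
      (\<forall>i < length h.
         length (steps_of (nth_run T k h i)) \<le> C * (k + 1)\<^sup>2 \<and>
         (\<forall>p ss. (p, ss) \<in> set (calls_of (nth_run T k h i)) \<longrightarrow>
            p \<in> {Insert_Proc, Consume_Proc, Prune_Proc} \<longrightarrow> length ss \<le> C1 * k) \<and>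
         (is_Transfer (snd (h ! i)) \<longrightarrow>
            length (steps_of (nth_run T k h i)) \<le> C2 * k\<^sup>2))"
\<comment> \<open>The bound \<open>66 * k\<^sup>2\<close> holds for every operation, so it yields
  both the general and the transfer bound.\<close>
proof (rule exI[of _ 66], rule exI[of _ 23], rule exI[of _ 66], intro allI impI conjI)
  fix T k i :: nat and h :: history
  assume "T > 0" "k > 0" "admissible h" "i < length h"
  note cost = nth_run_cost[OF this]
  then show "length (steps_of (nth_run T k h i)) \<le> 66 * k\<^sup>2" by blast
  also have "\<dots> \<le> 66 * (k + 1)\<^sup>2"
    by (simp add: power_mono)
  finally show "length (steps_of (nth_run T k h i)) \<le> 66 * (k + 1)\<^sup>2" .
  show "length ss \<le> 23 * k" if "(p, ss) \<in> set (calls_of (nth_run T k h i))" for p ss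
    using cost that by blast
qed

end
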